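(* Let $G$ be the communication graph of a system, and let $F_1=(f_1,g_1)$ and $F_2=(f_2,g_2)$ be two different synchronization schedules on $G$. Then the synchronized communication system on $G$ using $F_1$ has the same uncovering-resilience as the synchronized communication system on $G$ using $F_2$.
   Context: Model. A system consists of pairwise disjoint unit circles $C_1,\dots,C_n$ in the plane (trajectories) and a communication range $r>0$. Its communication graph $G$ has vertex set $\{C_1,\dots,C_n\}$, $C_i,C_j$ adjacent iff the distance between their centres is at most $2+r$. Positions on a circle are angles (mod $2\pi$). For an edge $(i,j)$, the link position $\phi_{ij}$ is the angle of the point of $C_i$ closest to $C_j$. A schedule $F=(f,g)$ assigns each circle a starting angle $f(C_i)\in[0,2\pi)$ and direction $g(C_i)\in\{1,-1\}$ ($1$ = counterclockwise); a robot following it on $C_i$ is at $f(C_i)+g(C_i)2\pi t$ at time $t$. $F$ is a synchronization schedule if $g(C_i)=-g(C_j)$ for adjacent circles and robots following $F$ on adjacent $C_i,C_j$ are at $\phi_{ij},\phi_{ji}$ at exactly the same times. A synchronized communication system (SCS) on $G$ consists of $n$ robots, initially one per circle, following a synchronization schedule, with the switching rule: when a robot on $C_i$ reaches $\phi_{ij}$ and $C_j$ is empty, it instantly passes to $C_j$ and from then on follows the schedule of $C_j$; if $C_j$ has a robot, they meet and each stays on its circle. A partial SCS arises by letting some robots leave (possibly at different times). A circle is covered if every point of it is visited periodically by the surviving robots. The uncovering-resilience of an SCS is the largest $k$ such that, whichever $k$ robots leave, all circles remain covered. *)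

theory Defs
  imports Complex_Main
begin

text \<open>Circles are indexed by 0..n-1; circle i is the unit circle with centre c i (a point
of the complex plane). Robots are indexed by their initial circle.\<close>

definition disjoint_unit_circles :: "nat \<Rightarrow> (nat \<Rightarrow> complex) \<Rightarrow> bool" where
  "disjoint_unit_circles n c \<longleftrightarrow> (\<forall>i<n. \<forall>j<n. i \<noteq> j \<longrightarrow> cmod (c i - c j) > 2)"

definition comm_adj :: "nat \<Rightarrow> (nat \<Rightarrow> complex) \<Rightarrow> real \<Rightarrow> nat \<Rightarrow> nat \<Rightarrow> bool" where
  "comm_adj n c r i j \<longleftrightarrow> i < n \<and> j < n \<and> i \<noteq> j \<and> cmod (c i - c j) \<le> 2 + r"

text \<open>Link position of edge (i,j): the point of circle i closest to circle j.\<close>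
definition link_point :: "(nat \<Rightarrow> complex) \<Rightarrow> nat \<Rightarrow> nat \<Rightarrow> complex" where
  "link_point c i j = c i + (c j - c i) / complex_of_real (cmod (c j - c i))"

definition sched_point :: "(nat \<Rightarrow> complex) \<Rightarrow> (nat \<Rightarrow> real) \<Rightarrow> (nat \<Rightarrow> real) \<Rightarrow> nat \<Rightarrow> real \<Rightarrow> complex" where
  "sched_point c f g i t = c i + cis (f i + g i * 2 * pi * t)"

definition sync_schedule :: "nat \<Rightarrow> (nat \<Rightarrow> complex) \<Rightarrow> real \<Rightarrow> (nat \<Rightarrow> real) \<Rightarrow> (nat \<Rightarrow> real) \<Rightarrow> bool" where
  "sync_schedule n c r f g \<longleftrightarrow>
     (\<forall>i<n. 0 \<le> f i \<and> f i < 2 * pi \<and> (g i = 1 \<or> g i = -1)) \<and>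
     (\<forall>i j. comm_adj n c r i j \<longrightarrow>
        g i = - g j \<and>
        (\<forall>t\<ge>0. sched_point c f g i t = link_point c i j \<longleftrightarrow> sched_point c f g j t = link_point c j i))"

text \<open>Switching rule at time t > 0: L is the configuration just before t, R the one at t.
  A robot on circle i that reaches the link position of an edge (i,j) whose circle j is empty
  (just before t) passes to circle j; otherwise it stays.\<close>
definition switch_ok :: "nat \<Rightarrow> (nat \<Rightarrow> complex) \<Rightarrow> real \<Rightarrow> (nat \<Rightarrow> real) \<Rightarrow> (nat \<Rightarrow> real)
     \<Rightarrow> (nat \<Rightarrow> nat option) \<Rightarrow> real \<Rightarrow> (nat \<Rightarrow> nat option) \<Rightarrow> bool" where
  "switch_ok n c r f g L t R \<longleftrightarrow>
     (\<forall>\<rho><n. \<forall>i. R \<rho> \<noteq> None \<longrightarrow> L \<rho> = Some i \<longrightarrow>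
        (let E = {j. comm_adj n c r i j \<and> sched_point c f g i t = link_point c i j
                     \<and> (\<forall>\<sigma><n. L \<sigma> \<noteq> Some j)}
         in if E = {} then R \<rho> = Some i else R \<rho> \<in> Some ` E))"

text \<open>A run of the partial SCS in which the robots in K leave at times tau:
  loc \<rho> t is the circle occupied by robot \<rho> at time t (None once it has left).\<close>
definition partial_scs_run :: "nat \<Rightarrow> (nat \<Rightarrow> complex) \<Rightarrow> real \<Rightarrow> (nat \<Rightarrow> real) \<Rightarrow> (nat \<Rightarrow> real)
     \<Rightarrow> nat set \<Rightarrow> (nat \<Rightarrow> real) \<Rightarrow> (nat \<Rightarrow> real \<Rightarrow> nat option) \<Rightarrow> bool" where
  "partial_scs_run n c r f g K tau loc \<longleftrightarrow>
     (\<forall>\<rho><n. \<forall>t\<ge>0. loc \<rho> t = None \<longleftrightarrow> (\<rho> \<in> K \<and> tau \<rho> \<le> t)) \<and>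
     (\<forall>\<rho><n. \<forall>t\<ge>0. \<forall>i. loc \<rho> t = Some i \<longrightarrow> i < n) \<and>
     (\<forall>\<rho><n. loc \<rho> 0 \<noteq> None \<longrightarrow> loc \<rho> 0 = Some \<rho>) \<and>
     (\<forall>t\<ge>0. \<exists>\<epsilon>>0. \<forall>\<rho><n. \<forall>s. t \<le> s \<and> s < t + \<epsilon> \<longrightarrow> loc \<rho> s = loc \<rho> t) \<and>
     (\<forall>t>0. \<exists>L. (\<exists>\<epsilon>>0. \<epsilon> \<le> t \<and> (\<forall>\<rho><n. \<forall>s. t - \<epsilon> < s \<and> s < t \<longrightarrow> loc \<rho> s = L \<rho>))
               \<and> switch_ok n c r f g L t (\<lambda>\<rho>. loc \<rho> t))"

text \<open>Robot \<rho> is on circle i at time t (including the instant at which it leaves i).\<close>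
definition on_circle :: "(nat \<Rightarrow> real \<Rightarrow> nat option) \<Rightarrow> nat \<Rightarrow> nat \<Rightarrow> real \<Rightarrow> bool" where
  "on_circle loc \<rho> i t \<longleftrightarrow> loc \<rho> t = Some i \<or>
     (\<exists>\<epsilon>>0. \<epsilon> \<le> t \<and> (\<forall>s. t - \<epsilon> < s \<and> s < t \<longrightarrow> loc \<rho> s = Some i))"

definition covered :: "nat \<Rightarrow> (nat \<Rightarrow> complex) \<Rightarrow> (nat \<Rightarrow> real) \<Rightarrow> (nat \<Rightarrow> real)
     \<Rightarrow> (nat \<Rightarrow> real \<Rightarrow> nat option) \<Rightarrow> nat \<Rightarrow> bool" where
  "covered n c f g loc i \<longleftrightarrow>
     (\<forall>p. cmod (p - c i) = 1 \<longrightarrow>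
        (\<exists>P>0. \<forall>t\<ge>0. \<exists>t'. t \<le> t' \<and> t' \<le> t + P \<and>
            (\<exists>\<rho><n. on_circle loc \<rho> i t') \<and> sched_point c f g i t' = p))"

definition uncovering_resilience :: "nat \<Rightarrow> (nat \<Rightarrow> complex) \<Rightarrow> real \<Rightarrow> (nat \<Rightarrow> real) \<Rightarrow> (nat \<Rightarrow> real) \<Rightarrow> nat" where
  "uncovering_resilience n c r f g =
     (GREATEST k. k \<le> n \<and>
        (\<forall>K tau loc. K \<subseteq> {..<n} \<and> card K = k \<and> (\<forall>\<rho>. 0 \<le> tau \<rho>) \<and>
             partial_scs_run n c r f g K tau loc \<longrightarrow> (\<forall>i<n. covered n c f g loc i)))"

end

theory Submission
  imports Defs
begin

text \<open>Let every circle carry a token that passes along each link it reaches, whether or not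
  the neighbouring circle is empty. Two tokens meeting at a link exchange their circles. If a token
  is called alive when its circle is occupied by a robot, then the switching rule says that a dead
  token stays dead and that each departure kills exactly one token. The tokens travelling along one closed ring are
  the shifts by full periods of a single periodic trajectory, and their number is its minimal
  period. Hence all circles stay covered after any \<open>k\<close> departures iff \<open>k\<close> is smaller than every
  period of a trajectory. On a connected component of the graph, two schedules differ by a shift of
  time and possibly its reversal, and both preserve the periods of trajectories.\<close>

section \<open>One-sided neighbourhoods of the real line\<close>

lemma eventually_at_left_shift:
  fixes t d :: real
  shows "(\<forall>\<^sub>F u in at_left t. P (u + d)) \<longleftrightarrow> (\<forall>\<^sub>F u in at_left (t + d). P u)"
proof
  assume "\<forall>\<^sub>F u in at_left t. P (u + d)"
  then obtain b where b: "b < t" "\<And>u. b < u \<Longrightarrow> u < t \<Longrightarrow> P (u + d)"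
    unfolding eventually_at_left_field by auto
  show "\<forall>\<^sub>F u in at_left (t + d). P u"
    unfolding eventually_at_left_field
    using b(1) b(2)[of "_ - d"] by (intro exI[of _ "b + d"]) (auto simp: algebra_simps)
next
  assume "\<forall>\<^sub>F u in at_left (t + d). P u"
  then obtain b where b: "b < t + d" "\<And>u. b < u \<Longrightarrow> u < t + d \<Longrightarrow> P u"
    unfolding eventually_at_left_field by auto
  show "\<forall>\<^sub>F u in at_left t. P (u + d)"
    unfolding eventually_at_left_field
    using b by (intro exI[of _ "b - d"]) (auto simp: algebra_simps)
qed

lemma eventually_at_left_reflect:
  fixes t d :: real
  shows "(\<forall>\<^sub>F u in at_left t. P (d - u)) \<longleftrightarrow> (\<forall>\<^sub>F u in at_right (d - t). P u)"
proof
  assume "\<forall>\<^sub>F u in at_left t. P (d - u)"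
  then obtain b where b: "b < t" "\<And>u. b < u \<Longrightarrow> u < t \<Longrightarrow> P (d - u)"
    unfolding eventually_at_left_field by auto
  have "P u" if "u > d - t" "u < d - b" for u
    using b(2)[of "d - u"] that by simp
  then show "\<forall>\<^sub>F u in at_right (d - t). P u"
    unfolding eventually_at_right_field
    using b(1) by (intro exI[of _ "d - b"]) auto
next
  assume "\<forall>\<^sub>F u in at_right (d - t). P u"
  then obtain b where b: "b > d - t" "\<And>u. d - t < u \<Longrightarrow> u < b \<Longrightarrow> P u"
    unfolding eventually_at_right_field by auto
  show "\<forall>\<^sub>F u in at_left t. P (d - u)"
    unfolding eventually_at_left_field
    using b by (intro exI[of _ "d - b"]) auto
qed

lemma eventually_at_right_reflect:
  fixes t d :: real
  shows "(\<forall>\<^sub>F u in at_right t. P (d - u)) \<longleftrightarrow> (\<forall>\<^sub>F u in at_left (d - t). P u)"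
  using eventually_at_left_reflect[of "\<lambda>u. P (d - u)" d "d - t"] by simp

lemma eventually_at_right_shift:
  fixes t d :: real
  shows "(\<forall>\<^sub>F u in at_right t. P (u + d)) \<longleftrightarrow> (\<forall>\<^sub>F u in at_right (t + d). P u)"
  using eventually_at_right_reflect[of "\<lambda>u. P (- u)" "-d" t]
    eventually_at_right_reflect[of "\<lambda>u. P (- u)" 0 "t + d"]
  by (simp add: add.commute)

text \<open>The infimum of the counterexamples satisfies \<open>P\<close> by \<open>left\<close> or
  \<open>base\<close>, and then \<open>right\<close> separates it from the counterexamples, which is
  absurd.\<close>

lemma real_induct [consumes 1, case_names base right left]:
  fixes t :: real
  assumes le: "a \<le> t" and base: "P a"
    and right: "\<And>t. a \<le> t \<Longrightarrow> P t \<Longrightarrow> \<forall>\<^sub>F u in at_right t. P u"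
    and left: "\<And>t. a < t \<Longrightarrow> (\<And>u. a \<le> u \<Longrightarrow> u < t \<Longrightarrow> P u) \<Longrightarrow> P t"
  shows "P t"
proof (rule ccontr)
  assume "\<not> P t"
  define S where "S = {u. a \<le> u \<and> \<not> P u}"
  have S: "S \<noteq> {}" "bdd_below S"
    using \<open>\<not> P t\<close> le by (auto simp: S_def bdd_below_def)
  have aS: "a \<le> Inf S"
    using S(1) by (rule cInf_greatest) (auto simp: S_def)
  have below: "P u" if "a \<le> u" "u < Inf S" for u
    using cInf_lower[OF _ S(2), of u] that by (auto simp: S_def)
  have "P (Inf S)"
    using left[of "Inf S"] below aS base by (cases "a = Inf S") auto
  with right[OF aS] obtain b where b: "b > Inf S" "\<And>u. Inf S < u \<Longrightarrow> u < b \<Longrightarrow> P u"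
    unfolding eventually_at_right_field by auto
  have "b \<le> Inf S"
  proof (rule cInf_greatest[OF S(1)])
    fix u assume "u \<in> S"
    then have "Inf S \<le> u" "\<not> P u" using cInf_lower[OF _ S(2)] by (auto simp: S_def)
    then show "b \<le> u" using b(2)[of u] \<open>P (Inf S)\<close> by (cases "u = Inf S"; force)
  qed
  with b(1) show False by simp
qed

lemma finite_eventually_at_left:
  fixes t :: real
  assumes "\<And>a b. finite {u. a \<le> u \<and> u \<le> b \<and> Q u}"
  shows "\<forall>\<^sub>F v in at_left t. \<forall>u. v \<le> u \<and> u < t \<longrightarrow> \<not> Q u"
proof -
  \<comment> \<open>Inserting \<open>t - 1\<close> makes \<open>F\<close> nonempty and bounds
    \<open>Max F\<close> from below, so that any \<open>u\<close> between \<open>Max F\<close> and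
    \<open>t\<close> with \<open>Q u\<close> falls into the finite window.\<close>
  define F where "F = insert (t - 1) ({u. t - 1 \<le> u \<and> u \<le> t \<and> Q u} - {t})"
  have F: "finite F" "F \<noteq> {}" "\<forall>u\<in>F. u < t"
    using assms[of "t - 1" t] by (auto simp: F_def)
  have "Max F < t" using F by simp
  moreover have "\<not> Q u" if "Max F < u" "u < t" for u
  proof
    assume "Q u"
    have "t - 1 \<le> Max F" using F by (simp add: F_def)
    then have "u \<in> F" using that \<open>Q u\<close> by (auto simp: F_def)
    then have "u \<le> Max F" using F by simp
    with that show False by simp
  qed
  ultimately show ?thesis
    unfolding eventually_at_left_field by (intro exI[of _ "Max F"]) auto
qed

lemma finite_eventually_at_right:
  fixes t :: real
  assumes fin: "\<And>a b. finite {u. a \<le> u \<and> u \<le> b \<and> Q u}"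
  shows "\<forall>\<^sub>F v in at_right t. \<forall>u. t < u \<and> u \<le> v \<longrightarrow> \<not> Q u"
proof -
  have "finite {u. a \<le> u \<and> u \<le> b \<and> Q (- u)}" for a b
  proof -
    have "{u. a \<le> u \<and> u \<le> b \<and> Q (- u)} = uminus -` {u. - b \<le> u \<and> u \<le> - a \<and> Q u}" by auto
    then show ?thesis using finite_vimageI[OF fin[of "-b" "-a"], of uminus] by simp
  qed
  from finite_eventually_at_left[OF this, of "-t"]
  have "\<forall>\<^sub>F v in at_left (- t). \<forall>u. v \<le> u \<and> u < - t \<longrightarrow> \<not> Q (- u)" .
  then have "\<forall>\<^sub>F v in at_left (- t). \<forall>u. t < u \<and> u \<le> 0 - v \<longrightarrow> \<not> Q u"
    by (rule eventually_mono) (metis add.inverse_inverse diff_0 minus_le_iff neg_less_iff_less)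
  then show ?thesis
    by (subst (asm) eventually_at_left_reflect) simp
qed

section \<open>Processes with locally finitely many jumps\<close>

locale jump_process =
  fixes J :: "real \<Rightarrow> 'a \<Rightarrow> 'a"
  assumes finite_jumps: "finite {u. a \<le> u \<and> u \<le> b \<and> J u \<noteq> id}"
begin

text \<open>With intervals open on the left and closed on the right, \<open>forward\<close> and
  \<open>backward\<close> both become right continuous.\<close>

definition jumps :: "real \<Rightarrow> real \<Rightarrow> real list" where
  "jumps a b = sorted_list_of_set {u. a < u \<and> u \<le> b \<and> J u \<noteq> id}"

lemma finite_jumps': "finite {u. a < u \<and> u \<le> b \<and> J u \<noteq> id}"
  by (rule finite_subset[OF _ finite_jumps[of a b]]) auto

definition forward :: "'a \<Rightarrow> real \<Rightarrow> 'a" where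
  "forward x t = fold J (jumps 0 t) x"

text \<open>Going left from 0, the maps \<open>J\<close> themselves are applied, not their inverses;
  for involutions this is the same.\<close>

definition backward :: "'a \<Rightarrow> real \<Rightarrow> 'a" where
  "backward x t = fold J (rev (jumps t 0)) x"

lemma jumps_empty: "jumps a a = []"
proof -
  have "{u. a < u \<and> u \<le> a \<and> J u \<noteq> id} = {}" by auto
  then show ?thesis by (simp only: jumps_def sorted_list_of_set_empty)
qed

lemma forward_0 [simp]: "forward x 0 = x"
  by (simp add: forward_def jumps_empty)

lemma backward_0 [simp]: "backward x 0 = x"
  by (simp add: backward_def jumps_empty)

lemma forward_invariant:
  assumes "I x" "\<And>t z. I z \<Longrightarrow> I (J t z)"
  shows "I (forward x t)"
proof -
  have "I (fold J ts x)" for ts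
    using assms by (induction ts arbitrary: x) auto
  then show ?thesis by (simp add: forward_def)
qed

lemma backward_invariant:
  assumes "I x" "\<And>t z. I z \<Longrightarrow> I (J t z)"
  shows "I (backward x t)"
proof -
  have "I (fold J ts x)" for ts
    using assms by (induction ts arbitrary: x) auto
  then show ?thesis by (simp add: backward_def)
qed

lemma jumps_cong:
  assumes "\<And>u. J u \<noteq> id \<Longrightarrow> a < u \<and> u \<le> b \<longleftrightarrow> a' < u \<and> u \<le> b'"
  shows "jumps a b = jumps a' b'"
  unfolding jumps_def using assms by (intro arg_cong[of _ _ sorted_list_of_set]) auto

lemma jumps_snoc:
  assumes "a \<le> v" "v < t" "\<forall>u. v < u \<and> u < t \<longrightarrow> J u = id"
  shows "fold J (jumps a t) x = J t (fold J (jumps a v) x)"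
proof (cases "J t = id")
  case True
  have "jumps a t = jumps a v"
    using assms True by (intro jumps_cong) (metis less_le_not_le linorder_not_less order.trans order_le_less)
  then show ?thesis using True by simp
next
  case False
  have "{u. a < u \<and> u \<le> t \<and> J u \<noteq> id} = insert t {u. a < u \<and> u \<le> v \<and> J u \<noteq> id}"
    (is "?A = ?B")
  proof
    show "?A \<subseteq> ?B"
      using assms by (auto simp: not_le)
    show "?B \<subseteq> ?A"
      using assms False by auto
  qed
  then have "jumps a t = insort t (jumps a v)"
    using assms finite_jumps'[of a v] by (simp add: jumps_def)
  also have "\<dots> = jumps a v @ [t]"
    using assms finite_jumps'[of a v] by (intro sorted_insort_is_snoc) (auto simp: jumps_def)
  finally show ?thesis by simp
qed

lemma jumps_Cons:
  assumes "t \<le> b" "v < t" "\<forall>u. v < u \<and> u < t \<longrightarrow> J u = id"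
  shows "fold J (rev (jumps v b)) x = J t (fold J (rev (jumps t b)) x)"
proof (cases "J t = id")
  case True
  have "jumps v b = jumps t b"
    using assms True by (intro jumps_cong) (metis linorder_less_linear order.strict_trans)
  then show ?thesis using True by simp
next
  case False
  have "{u. v < u \<and> u \<le> b \<and> J u \<noteq> id} = insert t {u. t < u \<and> u \<le> b \<and> J u \<noteq> id}"
    (is "?A = ?B")
  proof
    show "?A \<subseteq> ?B"
      using assms by auto
    show "?B \<subseteq> ?A"
      using assms False by auto
  qed
  then have "jumps v b = insort t (jumps t b)"
    using finite_jumps'[of t b] by (simp add: jumps_def)
  also have "\<dots> = t # jumps t b"
    using finite_jumps'[of t b] by (intro insort_is_Cons) (auto simp: jumps_def)
  finally show ?thesis by simp
qed

lemma forward_right: "0 \<le> t \<Longrightarrow> \<forall>\<^sub>F u in at_right t. forward x u = forward x t"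
  using finite_eventually_at_right[OF finite_jumps, of t] eventually_at_right_less[of t]
proof eventually_elim
  case (elim v)
  then have "jumps 0 v = jumps 0 t"
    by (intro jumps_cong) (meson linorder_not_less order.trans order_less_imp_le)
  then show ?case by (simp add: forward_def)
qed

lemma forward_left:
  assumes "0 < t"
  obtains z where "\<forall>\<^sub>F u in at_left t. forward x u = z" "forward x t = J t z"
proof -
  obtain b where b: "b < t" "\<And>v. b < v \<Longrightarrow> v < t \<Longrightarrow> \<forall>u. v \<le> u \<and> u < t \<longrightarrow> J u = id"
    using finite_eventually_at_left[OF finite_jumps, of t] unfolding eventually_at_left_field by auto
  \<comment> \<open>A sample time that is nonnegative, as \<open>jumps_snoc\<close> demands, and has
    no jump between it and \<open>t\<close>.\<close>
  define v where "v = (max b 0 + t) / 2"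
  have v: "b < v" "0 < v" "v < t" using assms b by (auto simp: v_def)
  have "forward x u = forward x v" if "v < u" "u < t" for u
  proof -
    have "jumps 0 u = jumps 0 v"
      using b(2)[of v] v that by (intro jumps_cong) (meson linorder_not_less order.trans order_less_imp_le order_le_less_trans)
    then show ?thesis by (simp add: forward_def)
  qed
  then have "\<forall>\<^sub>F u in at_left t. forward x u = forward x v"
    unfolding eventually_at_left_field using v by auto
  moreover have "forward x t = J t (forward x v)"
    unfolding forward_def using v b(2)[of v] by (intro jumps_snoc) auto
  ultimately show ?thesis by (rule that)
qed

lemma backward_left: 
  assumes "t \<le> 0"
  shows "\<forall>\<^sub>F u in at_left t. backward x u = J t (backward x t)"
  using finite_eventually_at_left[OF finite_jumps, of t] eventually_at_left_real[of "t - 1" t, simplified]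
proof eventually_elim
  case (elim v)
  then show ?case
    unfolding backward_def using assms by (intro jumps_Cons) auto
qed

lemma backward_right:
  assumes "t < 0"
  shows "\<forall>\<^sub>F u in at_right t. backward x u = backward x t"
  using finite_eventually_at_right[OF finite_jumps, of t] eventually_at_right_real[OF assms]
proof eventually_elim
  case (elim v)
  then have "jumps v 0 = jumps t 0"
    by (intro jumps_cong) (meson greaterThanLessThan_iff linorder_not_less order_less_trans)
  then show ?case by (simp add: backward_def)
qed

end

section \<open>Periodic families of involutions\<close>

text \<open>This is what a schedule contributes to the motion of tokens: \<open>s t\<close>
  exchanges the circles that meet at a link at time \<open>t\<close>, and a revolution takes one
  unit of time.\<close>

locale swap_system =
  fixes n :: nat and s :: "real \<Rightarrow> nat \<Rightarrow> nat"
  assumes invol [simp]: "s t (s t i) = i"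
    and swap_less [simp]: "i < n \<Longrightarrow> s t i < n"
    and periodic: "s (t + 1) = s t"
    and finite_swaps: "finite {u. a \<le> u \<and> u \<le> b \<and> s u \<noteq> id}"
begin

sublocale jump_process s
  by standard (rule finite_swaps)

lemma swap_eq_iff [simp]: "s t i = s t j \<longleftrightarrow> i = j"
  by (metis invol)

lemma periodic_nat: "s (t + real k) = s t"
proof (induction k)
  case (Suc k)
  then show ?case using periodic[of "t + real k"] by (simp add: algebra_simps)
qed simp

lemma periodic_int: "s (t + of_int k) = s t"
proof (cases k)
  case (nonneg m)
  then show ?thesis using periodic_nat by simp
next
  case (neg m)
  then show ?thesis using periodic_nat[of "t + of_int k" "Suc m"] by simp
qed

text \<open>Trajectories are right continuous; as \<open>s t\<close> is an involution, \<open>s t (y t)\<close> is the left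
  limit at \<open>t\<close>, so that the notion is symmetric under reversal of time.\<close>

definition trajectory :: "(real \<Rightarrow> nat) \<Rightarrow> bool" where
  "trajectory y \<longleftrightarrow> (\<forall>t. y t < n \<and> (\<forall>\<^sub>F u in at_right t. y u = y t)
     \<and> (\<forall>\<^sub>F u in at_left t. y u = s t (y t)))"

lemma trajectory_less: "trajectory y \<Longrightarrow> y t < n"
  and trajectory_right: "trajectory y \<Longrightarrow> \<forall>\<^sub>F u in at_right t. y u = y t"
  and trajectory_left: "trajectory y \<Longrightarrow> \<forall>\<^sub>F u in at_left t. y u = s t (y t)"
  by (auto simp: trajectory_def)

text \<open>The truth value of \<open>Q (y t)\<close> is locally constant in \<open>t\<close>, hence
  constant on the connected real line.\<close>

lemma trajectory_invariant:
  assumes y: "trajectory y" and "Q (y a)"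
    and Q: "\<And>t i. i < n \<Longrightarrow> Q (s t i) \<longleftrightarrow> Q i"
  shows "Q (y b)"
proof -
  have "Q (y a) = Q (y b)"
  proof (rule connected_local_const[of UNIV a b "\<lambda>t. Q (y t)"])
    show "\<forall>t\<in>UNIV. \<forall>\<^sub>F u in at t. Q (y t) = Q (y u)"
    proof
      fix t
      have "\<forall>\<^sub>F u in at_left t. Q (y t) = Q (y u)"
        using trajectory_left[OF y, of t] by eventually_elim (simp add: Q trajectory_less[OF y])
      moreover have "\<forall>\<^sub>F u in at_right t. Q (y t) = Q (y u)"
        using trajectory_right[OF y, of t] by eventually_elim simp
      ultimately show "\<forall>\<^sub>F u in at t. Q (y t) = Q (y u)"
        by (simp add: eventually_at_split)
    qed
  qed auto
  with assms show ?thesis by simp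
qed

text \<open>As \<open>s t\<close> is injective, both agreement and disagreement of \<open>y\<close>
  and \<open>z\<close> persist locally; connectedness of the line does the rest.\<close>

lemma trajectory_unique:
  assumes y: "trajectory y" and z: "trajectory z" and "y a = z a"
  shows "y = z"
proof
  fix b
  have "(y a = z a) = (y b = z b)"
  proof (rule connected_local_const[of UNIV a b "\<lambda>t. y t = z t"])
    show "\<forall>t\<in>UNIV. \<forall>\<^sub>F u in at t. (y t = z t) = (y u = z u)"
    proof
      fix t
      have "\<forall>\<^sub>F u in at_left t. (y t = z t) = (y u = z u)"
        using trajectory_left[OF y, of t] trajectory_left[OF z, of t] by eventually_elim simp
      moreover have "\<forall>\<^sub>F u in at_right t. (y t = z t) = (y u = z u)"
        using trajectory_right[OF y, of t] trajectory_right[OF z, of t] by eventually_elim simp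
      ultimately show "\<forall>\<^sub>F u in at t. (y t = z t) = (y u = z u)"
        by (simp add: eventually_at_split)
    qed
  qed auto
  with assms show "y b = z b" by simp
qed

lemma trajectory_shift:
  assumes "trajectory y"
  shows "trajectory (\<lambda>t. y (t + of_int k))"
  unfolding trajectory_def
proof safe
  fix t
  show "y (t + of_int k) < n" using assms by (rule trajectory_less)
  show "\<forall>\<^sub>F u in at_right t. y (u + of_int k) = y (t + of_int k)"
    by (subst eventually_at_right_shift) (rule trajectory_right[OF assms])
  show "\<forall>\<^sub>F u in at_left t. y (u + of_int k) = s t (y (t + of_int k))"
    by (subst eventually_at_left_shift) (use trajectory_left[OF assms] periodic_int in metis)
qed

lemma trajectory_exists_0:
  assumes "x < n"
  obtains y where "trajectory y" "y 0 = x"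
proof -
  define y where "y t = (if 0 \<le> t then forward x t else backward x t)" for t
  have "y t < n" for t
    unfolding y_def using forward_invariant[of "\<lambda>i. i < n"] backward_invariant[of "\<lambda>i. i < n"] assms by auto
  moreover have "\<forall>\<^sub>F u in at_right t. y u = y t" for t
  proof (cases "0 \<le> t")
    case True
    show ?thesis
      using forward_right[OF True, of x] eventually_at_right_less[of t]
      by eventually_elim (use True in \<open>auto simp: y_def\<close>)
  next
    case False
    then have "t < 0" by simp
    from backward_right[OF this, of x] eventually_at_right_real[OF this] show ?thesis
      by eventually_elim (use False in \<open>auto simp: y_def\<close>)
  qed
  moreover have "\<forall>\<^sub>F u in at_left t. y u = s t (y t)" for t
  proof (cases "0 < t")
    case True
    \<comment> \<open>Here \<open>z\<close> is the left limit; applying the involution to the second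
      equation gives \<open>z = s t (y t)\<close>, the form that \<open>trajectory\<close> asks
      for.\<close>
    then obtain z where z: "\<forall>\<^sub>F u in at_left t. forward x u = z" "forward x t = s t z"
      using forward_left by blast
    from z(1) eventually_at_left_real[OF True] show ?thesis
      by eventually_elim (use True z(2) in \<open>auto simp: y_def\<close>)
  next
    case False
    then have "y t = backward x t" by (auto simp: y_def)
    moreover have "t \<le> 0" using False by simp
    from backward_left[OF this, of x] eventually_at_left_real[of "t - 1" t, simplified]
    have "\<forall>\<^sub>F u in at_left t. y u = s t (backward x t)"
      by eventually_elim (use False in \<open>auto simp: y_def\<close>)
    ultimately show ?thesis by simp
  qed
  ultimately have "trajectory y" by (simp add: trajectory_def)
  then show ?thesis using that by (simp add: y_def)
qed

end

text \<open>This allows the origin of time to be moved, so that a trajectory can be prescribed at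
  any time and not only at 0.\<close>

lemma (in swap_system) swap_system_shift: "swap_system n (\<lambda>t. s (t + d))"
proof
  show "s (t + 1 + d) = s (t + d)" for t
    using periodic[of "t + d"] by (simp add: algebra_simps)
  show "finite {u. a \<le> u \<and> u \<le> b \<and> s (u + d) \<noteq> id}" for a b
  proof -
    have "{u. a \<le> u \<and> u \<le> b \<and> s (u + d) \<noteq> id}
        = (\<lambda>u. u + d) -` {u. a + d \<le> u \<and> u \<le> b + d \<and> s u \<noteq> id}" by auto
    then show ?thesis using finite_vimageI[OF finite_swaps[of "a + d" "b + d"], of "\<lambda>u. u + d"]
      by (simp add: inj_on_def)
  qed
qed simp_all

lemma (in swap_system) trajectory_exists:
  assumes "x < n"
  obtains y where "trajectory y" "y a = x"
proof -
  interpret sh: swap_system n "\<lambda>t. s (t + a)" by (rule swap_system_shift)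
  obtain z where z: "sh.trajectory z" "z 0 = x"
    using sh.trajectory_exists_0[OF assms] .
  have "trajectory (\<lambda>t. z (t + - a))"
    unfolding trajectory_def
  proof safe
    fix t
    show "z (t + - a) < n" by (rule sh.trajectory_less[OF z(1)])
    show "\<forall>\<^sub>F u in at_right t. z (u + - a) = z (t + - a)"
      by (subst eventually_at_right_shift) (rule sh.trajectory_right[OF z(1)])
    show "\<forall>\<^sub>F u in at_left t. z (u + - a) = s t (z (t + - a))"
      by (subst eventually_at_left_shift) (use sh.trajectory_left[OF z(1), of "t + -a"] in simp)
  qed
  then show ?thesis using that z(2) by simp
qed

section \<open>Periods of trajectories\<close>

context swap_system begin

definition has_period :: "nat \<Rightarrow> (real \<Rightarrow> nat) \<Rightarrow> bool" where
  "has_period m y \<longleftrightarrow> m > 0 \<and> trajectory y \<and> (\<forall>t. y (t + real m) = y t)"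

text \<open>A shift by whole revolutions is again a trajectory, and two trajectories that agree once
  are equal.\<close>

lemma has_period_if_revisit:
  assumes y: "trajectory y" and "a < b" "y (t - real a) = y (t - real b)"
  shows "has_period (b - a) y"
proof -
  have "(\<lambda>u. y (u + of_int (int (b - a)))) = y"
    using assms by (intro trajectory_unique[OF trajectory_shift[OF y] y, of "t - real b"]) (auto simp: of_nat_diff)
  then show ?thesis
    using assms by (auto simp: has_period_def dest: fun_cong)
qed

text \<open>Pigeonhole: \<open>n + 1\<close> whole revolutions back in time, but only
  \<open>n\<close> circles to be on.\<close>

lemma ex_has_period:
  assumes y: "trajectory y"
  shows "\<exists>m. has_period m y"
proof -
  have "\<not> inj_on (\<lambda>k. y (0 - real k)) {..n}"
  proof
    assume "inj_on (\<lambda>k. y (0 - real k)) {..n}"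
    then have "card ((\<lambda>k. y (0 - real k)) ` {..n}) = Suc n" by (simp add: card_image)
    moreover have "card ((\<lambda>k. y (0 - real k)) ` {..n}) \<le> card {..<n}"
      using trajectory_less[OF y] by (intro card_mono) auto
    ultimately show False by simp
  qed
  then obtain a b where "a < b" "y (0 - real a) = y (0 - real b)"
    unfolding inj_on_def by (metis linorder_neqE_nat)
  then show ?thesis using has_period_if_revisit[OF y] by blast
qed

text \<open>For the least period \<open>m\<close>, the delays by 0 to \<open>m - 1\<close>
  revolutions are distinct tokens of one ring, and at no time do two of them share a circle.\<close>

lemma minimal_period:
  assumes y: "trajectory y"
  obtains m where "has_period m y" "\<And>t. inj_on (\<lambda>l. y (t - real l)) {..<m}"
proof -
  define m where "m = (LEAST m. has_period m y)"
  have m: "has_period m y" unfolding m_def using ex_has_period[OF y] by (rule LeastI_ex)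
  have min: "m \<le> k" if "has_period k y" for k unfolding m_def using that by (rule Least_le)
  have *: False if "a < b" "b < m" "y (t - real a) = y (t - real b)" for a b t
    using min[OF has_period_if_revisit[OF y that(1,3)]] that by linarith
  have "inj_on (\<lambda>l. y (t - real l)) {..<m}" for t
    by (rule inj_onI) (metis * lessThan_iff linorder_neqE_nat)
  with m show ?thesis by (rule that)
qed

lemma has_period_int:
  assumes "has_period m y"
  shows "y (t + real m * of_int k) = y t"
proof -
  have nat: "y (t + real m * real k) = y t" for t k
  proof (induction k)
    case (Suc k)
    then show ?case
      using assms by (auto simp: has_period_def algebra_simps dest: spec[of _ "t + real m * real k"])
  qed simp
  show ?thesis
  proof (cases k)
    case (nonneg j)
    then show ?thesis using nat by simp
  next
    case (neg j)
    have "t + real m * of_int k + real m * real (Suc j) = t"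
      unfolding neg by (simp add: algebra_simps)
    then show ?thesis using nat[of "t + real m * of_int k" "Suc j"] by (simp only:)
  qed
qed

text \<open>The circles visited at whole times are the starting circles of the tokens of one ring;
  reducing times modulo \<open>m\<close> leaves at most \<open>m\<close> of them.\<close>

lemma periodic_orbit:
  assumes "has_period m y"
  shows "card (range (\<lambda>k. y (of_int k))) \<le> m" "range (\<lambda>k. y (of_int k)) \<subseteq> {..<n}"
proof -
  have m: "m > 0" using assms by (simp add: has_period_def)
  have "range (\<lambda>k. y (of_int k)) \<subseteq> (\<lambda>l. y (real l)) ` {..<m}"
  proof safe
    fix k :: int
    have "y (of_int k) = y (of_int (k mod int m) + real m * of_int (k div int m))"
      by (metis mod_mult_div_eq of_int_add of_int_mult of_int_of_nat_eq)
    also have "\<dots> = y (real (nat (k mod int m)))"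
      using m by (simp only: has_period_int[OF assms]) simp
    finally show "y (of_int k) \<in> (\<lambda>l. y (real l)) ` {..<m}"
      using m by (intro image_eqI[of _ _ "nat (k mod int m)"]) (auto simp: nat_less_iff)
  qed
  then have "card (range (\<lambda>k. y (of_int k))) \<le> card ((\<lambda>l. y (real l)) ` {..<m})"
    by (intro card_mono) auto
  also have "\<dots> \<le> m" using card_image_le[of "{..<m}"] by simp
  finally show "card (range (\<lambda>k. y (of_int k))) \<le> m" .
  show "range (\<lambda>k. y (of_int k)) \<subseteq> {..<n}"
    using assms trajectory_less by (auto simp: has_period_def)
qed

end

section \<open>The swaps of a synchronization schedule\<close>

lemma cis_eq_iff: "cis a = cis b \<longleftrightarrow> (\<exists>k::int. a = b + 2 * pi * k)"
  using sin_cos_eq_iff[of a b] by (auto simp: complex_eq_iff)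

text \<open>Occupancy is ignored: this is the motion of tokens, not of robots. The description is
  well defined by \<open>link_unique\<close>.\<close>

definition swap :: "nat \<Rightarrow> (nat \<Rightarrow> complex) \<Rightarrow> real \<Rightarrow> (nat \<Rightarrow> real) \<Rightarrow> (nat \<Rightarrow> real) \<Rightarrow> real \<Rightarrow> nat \<Rightarrow> nat" where
  "swap n c r f g t i =
     (if \<exists>j. comm_adj n c r i j \<and> sched_point c f g i t = link_point c i j
      then THE j. comm_adj n c r i j \<and> sched_point c f g i t = link_point c i j else i)"

locale sync_system =
  fixes n :: nat and c :: "nat \<Rightarrow> complex" and r :: real and f g :: "nat \<Rightarrow> real"
  assumes disjoint: "disjoint_unit_circles n c" and sync: "sync_schedule n c r f g"
begin

abbreviation adj :: "nat \<Rightarrow> nat \<Rightarrow> bool" where "adj \<equiv> comm_adj n c r"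
abbreviation pos :: "nat \<Rightarrow> real \<Rightarrow> complex" where "pos \<equiv> sched_point c f g"
abbreviation link :: "nat \<Rightarrow> nat \<Rightarrow> complex" where "link \<equiv> link_point c"
abbreviation sw :: "real \<Rightarrow> nat \<Rightarrow> nat" where "sw \<equiv> swap n c r f g"

lemma adj_sym: "adj i j \<Longrightarrow> adj j i"
  by (auto simp: comm_adj_def norm_minus_commute)

lemma adj_less: "adj i j \<Longrightarrow> i < n" "adj i j \<Longrightarrow> j < n"
  by (auto simp: comm_adj_def)

lemma g_cases: "i < n \<Longrightarrow> g i = 1 \<or> g i = -1"
  using sync by (auto simp: sync_schedule_def)

lemma g_adj: "adj i j \<Longrightarrow> g i = - g j"
  using sync by (auto simp: sync_schedule_def)

text \<open>The starting angle cancels, and a sign does not affect integrality.\<close>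

lemma pos_eq_iff:
  assumes "i < n"
  shows "pos i t = pos i u \<longleftrightarrow> t - u \<in> \<int>"
proof -
  have "pos i t = pos i u \<longleftrightarrow> (\<exists>k::int. f i + g i * 2 * pi * t = f i + g i * 2 * pi * u + 2 * pi * k)"
    by (simp add: sched_point_def cis_eq_iff)
  also have "\<dots> \<longleftrightarrow> (\<exists>k::int. 2 * pi * (g i * (t - u)) = 2 * pi * k)"
    by (simp add: algebra_simps)
  also have "\<dots> \<longleftrightarrow> g i * (t - u) \<in> \<int>"
    by (auto simp: Ints_def)
  also have "\<dots> \<longleftrightarrow> t - u \<in> \<int>"
    using g_cases[OF assms] by (auto simp: minus_in_Ints_iff[of "t - u", symmetric] simp del: minus_in_Ints_iff)
  finally show ?thesis .
qed

lemma pos_periodic: "i < n \<Longrightarrow> pos i (t + of_int k) = pos i t"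
  by (simp add: pos_eq_iff)

lemma pos_surj:
  assumes "i < n" "cmod (p - c i) = 1"
  obtains t where "pos i t = p"
proof -
  have "cis (Arg (p - c i)) = p - c i"
    using assms(2) cis_Arg[of "p - c i"] by (force simp: sgn_div_norm)
  moreover have "f i + g i * 2 * pi * (g i * (Arg (p - c i) - f i) / (2 * pi)) = Arg (p - c i)"
    using g_cases[OF assms(1)] by auto
  ultimately have "pos i (g i * (Arg (p - c i) - f i) / (2 * pi)) = p"
    by (simp only: sched_point_def) simp
  then show ?thesis by (rule that)
qed

lemma adj_centre_neq: "adj i j \<Longrightarrow> c i \<noteq> c j"
  using disjoint by (force simp: comm_adj_def disjoint_unit_circles_def)

lemma norm_link: "adj i j \<Longrightarrow> cmod (link i j - c i) = 1"
  using adj_centre_neq[of i j] by (simp add: link_point_def norm_divide)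

text \<open>Synchrony is assumed for nonnegative times only; adding enough whole revolutions extends
  it to the whole line, on which trajectories live.\<close>

lemma pos_link_iff:
  assumes "adj i j"
  shows "pos i t = link i j \<longleftrightarrow> pos j t = link j i"
proof -
  define k where "k = \<lceil>\<bar>t\<bar>\<rceil>"
  have "0 \<le> t + of_int k" unfolding k_def by linarith
  then have "pos i (t + of_int k) = link i j \<longleftrightarrow> pos j (t + of_int k) = link j i"
    using sync assms by (auto simp: sync_schedule_def)
  then show ?thesis
    using pos_periodic adj_less[OF assms] by simp
qed

text \<open>If two links of a circle pointed in the same direction, the three circles would be pairwise
  adjacent, but neighbours alternate in direction.\<close>
lemma link_unique:
  assumes ij: "adj i j" and ik: "adj i k" and eq: "link i j = link i k"
  shows "j = k"
proof (rule ccontr)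
  assume "j \<noteq> k"
  define w where "w = (c j - c i) / complex_of_real (cmod (c j - c i))"
  have w: "w = (c k - c i) / complex_of_real (cmod (c k - c i))"
    using eq by (simp add: w_def link_point_def)
  have "cmod w = 1"
    using adj_centre_neq[OF ij] by (simp add: w_def norm_divide)
  have j: "c j = c i + complex_of_real (cmod (c j - c i)) * w"
    using adj_centre_neq[OF ij] by (simp add: w_def)
  have k: "c k = c i + complex_of_real (cmod (c k - c i)) * w"
    using adj_centre_neq[OF ik] by (simp add: w)
  \<comment> \<open>Both centres lie on one ray from \<open>c i\<close>, so their distance is the
    difference of two distances that are at most \<open>2 + r\<close>.\<close>
  have "c j - c k = complex_of_real (cmod (c j - c i) - cmod (c k - c i)) * w"
    by (subst j, subst k) (simp add: algebra_simps)
  then have "cmod (c j - c k) = \<bar>cmod (c j - c i) - cmod (c k - c i)\<bar>"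
    using \<open>cmod w = 1\<close> by (simp add: norm_mult del: of_real_diff)
  also have "\<dots> \<le> 2 + r"
    using adj_sym[OF ij] adj_sym[OF ik] norm_ge_zero[of "c j - c i"] norm_ge_zero[of "c k - c i"]
    unfolding comm_adj_def by linarith
  finally have "adj j k"
    using ij ik \<open>j \<noteq> k\<close> by (simp add: comm_adj_def)
  then show False
    using g_adj[OF ij] g_adj[OF ik] g_adj[of j k] g_cases[OF adj_less(1)[OF ij]] by auto
qed

lemma swap_eqI:
  assumes "adj i j" "pos i t = link i j"
  shows "sw t i = j"
proof -
  have "(THE j. adj i j \<and> pos i t = link i j) = j"
    using assms link_unique by (intro the_equality) auto
  then show ?thesis using assms by (auto simp: swap_def)
qed

lemma swap_cases:
  obtains "adj i (sw t i)" "pos i t = link i (sw t i)"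
  | "sw t i = i" "\<And>j. adj i j \<Longrightarrow> pos i t \<noteq> link i j"
proof (cases "\<exists>j. adj i j \<and> pos i t = link i j")
  case True
  then show ?thesis using swap_eqI that(1) by blast
next
  case False
  then have "sw t i = i" unfolding swap_def by (rule if_not_P)
  then show ?thesis using False that(2) by blast
qed

sublocale swap_system n sw
proof
  fix t i
  show "sw t (sw t i) = i"
  proof (cases rule: swap_cases[of i t])
    case 1
    then show ?thesis using swap_eqI adj_sym pos_link_iff by blast
  qed simp
  show "sw t i < n" if "i < n"
    using that adj_less(2) by (cases rule: swap_cases[of i t]) auto
next
  fix t
  show "sw (t + 1) = sw t"
  proof
    fix i
    have "adj i j \<Longrightarrow> pos i (t + 1) = pos i t" for j
      using pos_periodic[of i t 1] by (simp add: adj_less)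
    then have "(adj i j \<and> pos i (t + 1) = link i j) \<longleftrightarrow> (adj i j \<and> pos i t = link i j)" for j
      by metis
    then show "sw (t + 1) i = sw t i" unfolding swap_def by presburger
  qed
next
  fix a b
  \<comment> \<open>A circle is at a given point only at times in a single class modulo 1, of which
    a bounded interval contains finitely many.\<close>
  have fin: "finite {u. a \<le> u \<and> u \<le> b \<and> pos i u = p}" if "i < n" for i p
  proof (cases "\<exists>u. pos i u = p")
    case True
    then obtain v where v: "pos i v = p" by blast
    have "{u. a \<le> u \<and> u \<le> b \<and> pos i u = p} \<subseteq> (\<lambda>k. v + of_int k) ` {\<lfloor>a - v\<rfloor>..\<lceil>b - v\<rceil>}"
    proof
      fix u assume u: "u \<in> {u. a \<le> u \<and> u \<le> b \<and> pos i u = p}"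
      then have "pos i u = pos i v" using v by simp
      then have "u - v \<in> \<int>" by (simp only: pos_eq_iff[OF that])
      then obtain k where "u - v = of_int k" by (auto elim: Ints_cases)
      then have "u = v + of_int k" by simp
      moreover have "k \<in> {\<lfloor>a - v\<rfloor>..\<lceil>b - v\<rceil>}"
        using u \<open>u - v = of_int k\<close> by simp linarith
      ultimately show "u \<in> (\<lambda>k. v + of_int k) ` {\<lfloor>a - v\<rfloor>..\<lceil>b - v\<rceil>}" by blast
    qed
    then show ?thesis by (rule finite_subset) simp
  qed simp
  have "{u. a \<le> u \<and> u \<le> b \<and> sw u \<noteq> id} \<subseteq> (\<Union>i<n. \<Union>j<n. {u. a \<le> u \<and> u \<le> b \<and> pos i u = link i j})"
  proof
    fix u assume u: "u \<in> {u. a \<le> u \<and> u \<le> b \<and> sw u \<noteq> id}"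
    then have "sw u \<noteq> id" by simp
    then obtain i where i: "sw u i \<noteq> i" using ext[of "sw u" id] by force
    have "adj i (sw u i) \<and> pos i u = link i (sw u i)"
    proof (rule swap_cases[of i u])
      assume "sw u i = i"
      with i show ?thesis by contradiction
    qed (rule conjI)
    then show "u \<in> (\<Union>i<n. \<Union>j<n. {u. a \<le> u \<and> u \<le> b \<and> pos i u = link i j})"
      using u adj_less[of i "sw u i"] by auto
  qed
  then show "finite {u. a \<le> u \<and> u \<le> b \<and> sw u \<noteq> id}"
    by (rule finite_subset) (use fin in auto)
qed

definition occupied :: "(nat \<Rightarrow> nat option) \<Rightarrow> nat \<Rightarrow> bool" where
  "occupied L i \<longleftrightarrow> (\<exists>\<sigma><n. L \<sigma> = Some i)"

text \<open>At most one link is reached at a time, so there is at most one circle to pass to. If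
  none is reached, \<open>sw t i = i\<close> is occupied by the robot itself and the same formula
  says that it stays.\<close>

lemma switch_ok_iff:
  "switch_ok n c r f g L t R \<longleftrightarrow>
    (\<forall>\<rho><n. \<forall>i. R \<rho> \<noteq> None \<longrightarrow> L \<rho> = Some i \<longrightarrow>
      R \<rho> = Some (if occupied L (sw t i) then i else sw t i))"
proof -
  have "(let E = {j. adj i j \<and> pos i t = link i j \<and> (\<forall>\<sigma><n. L \<sigma> \<noteq> Some j)}
         in if E = {} then R \<rho> = Some i else R \<rho> \<in> Some ` E) \<longleftrightarrow>
        R \<rho> = Some (if occupied L (sw t i) then i else sw t i)"
    if "\<rho> < n" "L \<rho> = Some i" for \<rho> i
  proof (cases rule: swap_cases[of i t])
    case 1
    have "adj i j \<and> pos i t = link i j \<longleftrightarrow> j = sw t i" for j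
      using 1 swap_eqI[of i j t] by blast
    then have "{j. adj i j \<and> pos i t = link i j \<and> (\<forall>\<sigma><n. L \<sigma> \<noteq> Some j)}
      = {j. j = sw t i \<and> \<not> occupied L j}"
      by (simp only: conj_assoc[symmetric] occupied_def not_ex de_Morgan_conj imp_conv_disj)
    then show ?thesis by (auto simp: Let_def)
  next
    case 2
    then have "{j. adj i j \<and> pos i t = link i j \<and> (\<forall>\<sigma><n. L \<sigma> \<noteq> Some j)} = {}" by auto
    moreover have "occupied L (sw t i)" using that 2 by (auto simp: occupied_def)
    ultimately show ?thesis by (simp only: Let_def) simp
  qed
  then show ?thesis unfolding switch_ok_def by (intro all_cong1) auto
qed

end

section \<open>Runs of a partial system\<close>

locale scs_run = sync_system +
  fixes K :: "nat set" and tau :: "nat \<Rightarrow> real" and loc :: "nat \<Rightarrow> real \<Rightarrow> nat option"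
  assumes run: "partial_scs_run n c r f g K tau loc"
begin

lemma loc_eq_None_iff: "\<rho> < n \<Longrightarrow> 0 \<le> t \<Longrightarrow> loc \<rho> t = None \<longleftrightarrow> \<rho> \<in> K \<and> tau \<rho> \<le> t"
  using run[unfolded partial_scs_run_def, THEN conjunct1] by blast

lemma loc_less: "\<rho> < n \<Longrightarrow> 0 \<le> t \<Longrightarrow> loc \<rho> t = Some i \<Longrightarrow> i < n"
  using run[unfolded partial_scs_run_def, THEN conjunct2, THEN conjunct1] by blast

lemma loc_0: "\<rho> < n \<Longrightarrow> loc \<rho> 0 = Some i \<Longrightarrow> i = \<rho>"
  using run[unfolded partial_scs_run_def, THEN conjunct2, THEN conjunct2, THEN conjunct1] by force

lemma loc_right:
  assumes "0 \<le> t"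
  shows "\<forall>\<^sub>F u in at_right t. \<forall>\<rho><n. loc \<rho> u = loc \<rho> t"
proof -
  obtain e where e: "e > 0" "\<forall>\<rho><n. \<forall>s. t \<le> s \<and> s < t + e \<longrightarrow> loc \<rho> s = loc \<rho> t"
    using run[unfolded partial_scs_run_def, THEN conjunct2, THEN conjunct2, THEN conjunct2, THEN conjunct1] assms
    by blast
  have "loc \<rho> u = loc \<rho> t" if "u > t" "u < t + e" "\<rho> < n" for \<rho> u
    using e(2)[rule_format, of \<rho> u] that by simp
  then show ?thesis
    unfolding eventually_at_right_field using e(1) by (intro exI[of _ "t + e"] conjI allI impI) simp_all
qed

text \<open>Departures are final, so a robot present at \<open>t\<close> was present just before and
  the switching rule tells where it came from.\<close>

lemma loc_left:
  assumes "0 < t"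
  obtains L where "\<forall>\<^sub>F u in at_left t. \<forall>\<rho><n. loc \<rho> u = L \<rho>"
    "\<And>\<rho> i. \<rho> < n \<Longrightarrow> loc \<rho> t = Some i \<Longrightarrow>
       \<exists>j<n. L \<rho> = Some j \<and> i = (if occupied L (sw t j) then j else sw t j)"
proof -
  obtain L e where e: "e > 0" "e \<le> t" "\<forall>\<rho><n. \<forall>s. t - e < s \<and> s < t \<longrightarrow> loc \<rho> s = L \<rho>"
    and sw: "switch_ok n c r f g L t (\<lambda>\<rho>. loc \<rho> t)"
    using run[unfolded partial_scs_run_def, THEN conjunct2, THEN conjunct2, THEN conjunct2, THEN conjunct2] assms
    by blast
  have "\<forall>\<^sub>F u in at_left t. \<forall>\<rho><n. loc \<rho> u = L \<rho>"
    unfolding eventually_at_left_field using e by (intro exI[of _ "t - e"]) auto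
  moreover have "\<exists>j<n. L \<rho> = Some j \<and> i = (if occupied L (sw t j) then j else sw t j)"
    if \<rho>: "\<rho> < n" "loc \<rho> t = Some i" for \<rho> i
  proof -
    define u where "u = t - e / 2"
    have u: "t - e < u" "u < t" "0 \<le> u" using e(1,2) by (auto simp: u_def)
    have L: "loc \<rho> u = L \<rho>" using e(3)[rule_format, OF \<rho>(1), of u] u by simp
    have "loc \<rho> u \<noteq> None"
      using loc_eq_None_iff[OF \<rho>(1), of t] loc_eq_None_iff[OF \<rho>(1), of u] \<rho>(2) u by auto
    then obtain j where j: "L \<rho> = Some j" using L by auto
    have "j < n" by (rule loc_less[OF \<rho>(1) u(3)]) (simp add: L j)
    moreover have "loc \<rho> t = Some (if occupied L (sw t j) then j else sw t j)"
      using sw[unfolded switch_ok_iff] j \<rho> by blast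
    ultimately show ?thesis using j \<rho>(2) by (metis option.inject)
  qed
  ultimately show ?thesis by (rule that)
qed

text \<open>A robot moves only onto a circle that was empty, and two robots cannot move onto the
  same circle because \<open>sw t\<close> is injective.\<close>

lemma loc_inj:
  assumes "0 \<le> t"
  shows "\<forall>\<rho><n. \<forall>\<sigma><n. \<forall>i. loc \<rho> t = Some i \<longrightarrow> loc \<sigma> t = Some i \<longrightarrow> \<rho> = \<sigma>"
  using assms
proof (induction rule: real_induct)
  case base
  then show ?case using loc_0 by blast
next
  case (right t)
  from loc_right[OF right(1)] show ?case
    by eventually_elim (use right(2) in auto)
next
  case (left t)
  obtain L where L: "\<forall>\<^sub>F u in at_left t. \<forall>\<rho><n. loc \<rho> u = L \<rho>"
    "\<And>\<rho> i. \<rho> < n \<Longrightarrow> loc \<rho> t = Some i \<Longrightarrow>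
       \<exists>j<n. L \<rho> = Some j \<and> i = (if occupied L (sw t j) then j else sw t j)"
    by (rule loc_left[OF left(1)]) (rule that)
  have "\<forall>\<^sub>F u in at_left t. \<forall>\<rho><n. \<forall>\<sigma><n. \<forall>i. L \<rho> = Some i \<longrightarrow> L \<sigma> = Some i \<longrightarrow> \<rho> = \<sigma>"
    using L(1) eventually_at_left_real[OF left(1)]
  proof eventually_elim
    case (elim u)
    with left(2)[of u] show ?case by simp
  qed
  from eventually_happens'[OF trivial_limit_at_left_real this]
  have inj: "\<rho> = \<sigma>" if "\<rho> < n" "\<sigma> < n" "L \<rho> = Some i" "L \<sigma> = Some i" for \<rho> \<sigma> i
    using that by blast
  show ?case
  proof safe
    fix \<rho> \<sigma> i assume *: "\<rho> < n" "\<sigma> < n" "loc \<rho> t = Some i" "loc \<sigma> t = Some i"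
    obtain j where j: "L \<rho> = Some j" "i = (if occupied L (sw t j) then j else sw t j)"
      using L(2)[OF *(1,3)] by blast
    obtain k where k: "L \<sigma> = Some k" "i = (if occupied L (sw t k) then k else sw t k)"
      using L(2)[OF *(2,4)] by blast
    have "occupied L j" "occupied L k" using j(1) k(1) *(1,2) unfolding occupied_def by blast+
    with j(2) k(2) have "j = k" by (auto split: if_splits)
    with j(1) k(1) show "\<rho> = \<sigma>" by (intro inj[OF *(1,2)]) simp_all
  qed
qed

text \<open>A dead token stays dead at a swap: a robot found on \<open>sw t i\<close> either came
  from \<open>i\<close>, which was empty, or stayed because \<open>i\<close> was occupied.\<close>

lemma unoccupied_step:
  assumes "0 < t" "\<forall>\<rho><n. \<not> (\<forall>\<^sub>F u in at_left t. loc \<rho> u = Some i)"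
  shows "\<not> occupied (\<lambda>\<rho>. loc \<rho> t) (sw t i)"
proof
  assume "occupied (\<lambda>\<rho>. loc \<rho> t) (sw t i)"
  then obtain \<rho> where \<rho>: "\<rho> < n" "loc \<rho> t = Some (sw t i)" by (auto simp: occupied_def)
  obtain L where L: "\<forall>\<^sub>F u in at_left t. \<forall>\<rho><n. loc \<rho> u = L \<rho>"
    "\<And>\<rho> i. \<rho> < n \<Longrightarrow> loc \<rho> t = Some i \<Longrightarrow>
       \<exists>j<n. L \<rho> = Some j \<and> i = (if occupied L (sw t j) then j else sw t j)"
    by (rule loc_left[OF assms(1)]) (rule that)
  have free: "\<not> occupied L i"
  proof
    assume "occupied L i"
    then obtain \<sigma> where "\<sigma> < n" "L \<sigma> = Some i" by (auto simp: occupied_def)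
    from L(1) have "\<forall>\<^sub>F u in at_left t. loc \<sigma> u = Some i"
      by eventually_elim (use \<open>\<sigma> < n\<close> \<open>L \<sigma> = Some i\<close> in simp)
    with assms(2) \<open>\<sigma> < n\<close> show False by blast
  qed
  obtain j where j: "L \<rho> = Some j" "sw t i = (if occupied L (sw t j) then j else sw t j)"
    using L(2)[OF \<rho>] by blast
  have "occupied L j" using j(1) \<rho>(1) unfolding occupied_def by blast
  with free j(2) show False by (metis invol)
qed

lemma unoccupied_forever:
  assumes y: "trajectory y" and "0 \<le> a" "a \<le> t" "\<not> occupied (\<lambda>\<rho>. loc \<rho> a) (y a)"
  shows "\<not> occupied (\<lambda>\<rho>. loc \<rho> t) (y t)"
  using assms(3)
proof (induction rule: real_induct)
  case base
  then show ?case using assms by simp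
next
  case (right t)
  from right(1) \<open>0 \<le> a\<close> have "0 \<le> t" by simp
  from loc_right[OF this] trajectory_right[OF y, of t] show ?case
    by eventually_elim (use right(2) in \<open>auto simp: occupied_def\<close>)
next
  case (left t)
  have "\<not> (\<forall>\<^sub>F u in at_left t. loc \<rho> u = Some (sw t (y t)))" if "\<rho> < n" for \<rho>
  proof
    assume "\<forall>\<^sub>F u in at_left t. loc \<rho> u = Some (sw t (y t))"
    with trajectory_left[OF y, of t] eventually_at_left_real[OF left(1)]
    have "\<forall>\<^sub>F u in at_left t. False"
    proof eventually_elim
      case (elim u)
      then have "occupied (\<lambda>\<rho>. loc \<rho> u) (y u)"
        using that unfolding occupied_def by auto
      with left(2)[of u] elim show ?case by simp
    qed
    then show False using eventually_happens'[OF trivial_limit_at_left_real] by blast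
  qed
  \<comment> \<open>The left limit of the token is \<open>sw t (y t)\<close>; a second swap leads
    back to \<open>y t\<close>.\<close>
  then have "\<not> occupied (\<lambda>\<rho>. loc \<rho> t) (sw t (sw t (y t)))"
    using left(1) \<open>0 \<le> a\<close> by (intro unoccupied_step) auto
  then show ?case by simp
qed

text \<open>The robots outside \<open>K\<close> never leave and sit on distinct circles, by
  \<open>loc_inj\<close>.\<close>

lemma card_unoccupied_le:
  assumes "K \<subseteq> {..<n}" "0 \<le> t"
  shows "card {i. i < n \<and> \<not> occupied (\<lambda>\<rho>. loc \<rho> t) i} \<le> card K"
proof -
  have present: "loc \<rho> t = Some (the (loc \<rho> t))" "\<rho> < n" if "\<rho> \<in> {..<n} - K" for \<rho>
    using that loc_eq_None_iff[of \<rho> t] assms(2) by auto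
  have "inj_on (\<lambda>\<rho>. the (loc \<rho> t)) ({..<n} - K)"
  proof (rule inj_onI)
    fix \<rho> \<sigma> assume *: "\<rho> \<in> {..<n} - K" "\<sigma> \<in> {..<n} - K" and eq: "the (loc \<rho> t) = the (loc \<sigma> t)"
    have "loc \<sigma> t = Some (the (loc \<rho> t))" unfolding eq by (rule present(1)[OF *(2)])
    with loc_inj[OF assms(2), rule_format, OF present(2)[OF *(1)] present(2)[OF *(2)] present(1)[OF *(1)]]
    show "\<rho> = \<sigma>" .
  qed
  then have "card ({..<n} - K) = card ((\<lambda>\<rho>. the (loc \<rho> t)) ` ({..<n} - K))"
    by (simp add: card_image)
  also have "\<dots> \<le> card {i. i < n \<and> occupied (\<lambda>\<rho>. loc \<rho> t) i}"
  proof (intro card_mono image_subsetI)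
    fix \<rho> assume "\<rho> \<in> {..<n} - K"
    note \<rho> = present[OF this]
    show "the (loc \<rho> t) \<in> {i. i < n \<and> occupied (\<lambda>\<rho>. loc \<rho> t) i}"
      using loc_less[OF \<rho>(2) assms(2) \<rho>(1)] \<rho> unfolding occupied_def by blast
  qed simp
  finally have "card ({..<n} - K) \<le> card {i. i < n \<and> occupied (\<lambda>\<rho>. loc \<rho> t) i}" .
  moreover have "card ({..<n} - K) = n - card K"
    using assms(1) by (simp add: card_Diff_subset finite_subset)
  moreover have "card {i. i < n \<and> occupied (\<lambda>\<rho>. loc \<rho> t) i}
      + card {i. i < n \<and> \<not> occupied (\<lambda>\<rho>. loc \<rho> t) i} = n"
  proof -
    have "{i. i < n \<and> occupied (\<lambda>\<rho>. loc \<rho> t) i} \<union> {i. i < n \<and> \<not> occupied (\<lambda>\<rho>. loc \<rho> t) i} = {..<n}"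
      by auto
    then show ?thesis by (subst card_Un_disjoint[symmetric]) auto
  qed
  moreover have "card K \<le> n" using card_mono[OF _ assms(1)] by simp
  ultimately show ?thesis by linarith
qed

lemma on_circle_if_eventually:
  assumes "0 < t" "\<forall>\<^sub>F u in at_left t. loc \<rho> u = Some i"
  shows "on_circle loc \<rho> i t"
proof -
  obtain b where b: "b < t" "\<And>u. b < u \<Longrightarrow> u < t \<Longrightarrow> loc \<rho> u = Some i"
    using assms(2) unfolding eventually_at_left_field by auto
  define e where "e = min t (t - b)"
  have "e > 0" "e \<le> t" "\<forall>s. t - e < s \<and> s < t \<longrightarrow> loc \<rho> s = Some i"
    using assms(1) b by (auto simp: e_def min_def split: if_splits)
  then show ?thesis unfolding on_circle_def by blast
qed

lemma on_circle_cases: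
  assumes "on_circle loc \<rho> i t"
  shows "loc \<rho> t = Some i \<or> (\<forall>\<^sub>F u in at_left t. loc \<rho> u = Some i)"
  using assms unfolding on_circle_def
proof
  assume "\<exists>e>0. e \<le> t \<and> (\<forall>s. t - e < s \<and> s < t \<longrightarrow> loc \<rho> s = Some i)"
  then obtain e where "e > 0" "\<forall>s. t - e < s \<and> s < t \<longrightarrow> loc \<rho> s = Some i" by blast
  then have "\<forall>\<^sub>F u in at_left t. loc \<rho> u = Some i"
    unfolding eventually_at_left_field by (intro exI[of _ "t - e"]) simp
  then show ?thesis ..
qed simp

text \<open>If a point is not visited for long enough, then the tokens that should pass it are all
  dead; among them are as many distinct ones as the ring through the point has tokens.\<close>

lemma covered_if_few_leave:
  assumes K: "K \<subseteq> {..<n}" and few: "\<And>m y. has_period m y \<Longrightarrow> card K < m" and i: "i < n"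
  shows "covered n c f g loc i"
  unfolding covered_def
proof (intro allI impI)
  fix p assume "cmod (p - c i) = 1"
  then obtain v where v: "pos i v = p" by (rule pos_surj[OF i])
  \<comment> \<open>The point \<open>p\<close> is due within one revolution and then once per
    revolution; fewer than \<open>n\<close> further passes are examined, so \<open>n + 2\<close> is
    ample.\<close>
  have "\<exists>t'. t \<le> t' \<and> t' \<le> t + (real n + 2) \<and> (\<exists>\<rho><n. on_circle loc \<rho> i t') \<and> pos i t' = p"
    if t: "0 \<le> t" for t
  proof (rule ccontr)
    assume no: "\<not> ?thesis"
    define u where "u = v + of_int (\<lfloor>t - v\<rfloor> + 1)"
    have u: "t < u" "u \<le> t + 1" unfolding u_def by linarith+
    have posu: "pos i (u + real l) = p" for l
      using pos_periodic[OF i, of v "\<lfloor>t - v\<rfloor> + 1 + int l"] v by (simp add: u_def add.assoc)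
    \<comment> \<open>The token whose left limit at \<open>u\<close> is \<open>i\<close>. If
      \<open>p\<close> is a link position, it changes circles at that very instant, hence the value
      \<open>sw u i\<close>.\<close>
    obtain y where y: "trajectory y" "y u = sw u i"
      by (rule trajectory_exists[OF swap_less[OF i]])
    obtain m where m: "has_period m y" and inj: "\<And>t. inj_on (\<lambda>l. y (t - real l)) {..<m}"
      by (rule minimal_period[OF y(1)]) (rule that)
    have "m \<le> n"
      using card_inj_on_le[OF inj[of 0], of "{..<n}"] trajectory_less[OF y(1)] by auto
    \<comment> \<open>A time by which every missed pass has occurred, so that all the dead tokens
      can be counted at once.\<close>
    define T where "T = u + real n"
    have dead: "\<not> occupied (\<lambda>\<rho>. loc \<rho> T) (y (T - real l))" if l: "l < m" for l
    proof -
      \<comment> \<open>The token that arrives at \<open>p\<close> on circle \<open>i\<close>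
        exactly \<open>l\<close> revolutions after \<open>y\<close> does.\<close>
      define z where "z = (\<lambda>t. y (t + of_int (- int l)))"
      have z: "trajectory z" unfolding z_def by (rule trajectory_shift[OF y(1)])
      have ul: "0 < u + real l" "u + real l \<le> T" "u + real l \<le> t + (real n + 2)"
        using u t l \<open>m \<le> n\<close> by (auto simp: T_def)
      have "\<forall>\<rho><n. \<not> on_circle loc \<rho> i (u + real l)"
      proof (intro allI impI notI)
        fix \<rho> assume "\<rho> < n" "on_circle loc \<rho> i (u + real l)"
        moreover have "t \<le> u + real l" using u(1) by simp
        ultimately show False using no posu[of l] ul(3) by blast
      qed
      then have "\<not> occupied (\<lambda>\<rho>. loc \<rho> (u + real l)) (sw (u + real l) i)"
        using on_circle_if_eventually[OF ul(1)] by (intro unoccupied_step[OF ul(1)]) blast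
      moreover have "z (u + real l) = sw (u + real l) i"
        using y(2) periodic_nat[of u l] by (simp add: z_def)
      ultimately have "\<not> occupied (\<lambda>\<rho>. loc \<rho> T) (z T)"
        using unoccupied_forever[OF z, of "u + real l" T] ul by simp
      then show ?thesis by (simp add: z_def)
    qed
    have "m = card ((\<lambda>l. y (T - real l)) ` {..<m})"
      using card_image[OF inj[of T]] by simp
    also have "\<dots> \<le> card {i. i < n \<and> \<not> occupied (\<lambda>\<rho>. loc \<rho> T) i}"
      using dead trajectory_less[OF y(1)] by (intro card_mono) auto
    also have "\<dots> \<le> card K"
      using card_unoccupied_le[OF K] u t by (simp add: T_def)
    finally show False using few[OF m] by simp
  qed
  then show "\<exists>P>0. \<forall>t\<ge>0. \<exists>t'\<ge>t. t' \<le> t + P \<and> (\<exists>\<rho><n. on_circle loc \<rho> i t') \<and> pos i t' = p"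
    by (intro exI[of _ "real n + 2"]) auto
qed

text \<open>All tokens of the ring of \<open>y\<close> are dead from the start, so a point shortly
  after the initial position on circle \<open>y 0\<close> is never visited.\<close>

lemma not_covered_if_orbit_leaves:
  assumes per: "has_period m y" and K: "\<And>k. y (of_int k) \<in> K" and tau: "\<And>\<rho>. \<rho> \<in> K \<Longrightarrow> tau \<rho> = 0"
  shows "\<not> covered n c f g loc (y 0)"
proof
  assume cov: "covered n c f g loc (y 0)"
  have y: "trajectory y" using per by (simp add: has_period_def)
  obtain b where b: "b > 0" "\<And>u. 0 < u \<Longrightarrow> u < b \<Longrightarrow> y u = y 0"
    using trajectory_right[OF y, of 0] unfolding eventually_at_right_field by auto
  \<comment> \<open>Strictly inside the interval on which \<open>y\<close> stays on
    \<open>y 0\<close>, so the left limit at a visit is also controlled; \<open>v < 1\<close> makes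
    the number \<open>k\<close> of revolutions before a visit nonnegative.\<close>
  define v where "v = min b 1 / 2"
  have v: "0 < v" "v < b" "v < 1" using b(1) by (auto simp: v_def)
  have "cmod (pos (y 0) v - c (y 0)) = 1" by (simp add: sched_point_def)
  from cov[unfolded covered_def, rule_format, OF this]
  obtain P where "\<forall>t\<ge>0. \<exists>t'\<ge>t. t' \<le> t + P \<and> (\<exists>\<rho><n. on_circle loc \<rho> (y 0) t') \<and> pos (y 0) t' = pos (y 0) v"
    by blast
  from this[rule_format, OF order_refl]
  obtain t \<rho> where t: "0 \<le> t" "\<rho> < n" "on_circle loc \<rho> (y 0) t" "pos (y 0) t = pos (y 0) v"
    by blast
  have "t - v \<in> \<int>" using t(4) by (simp only: pos_eq_iff[OF trajectory_less[OF y]])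
  then obtain k where k: "t = v + of_int k" by (metis Ints_cases add.commute diff_add_cancel)
  with t(1) v(3) have "k > -1" by linarith
  then have "k \<ge> 0" by simp
  define z where "z = (\<lambda>u. y (u + of_int (- k)))"
  have z: "trajectory z" unfolding z_def by (rule trajectory_shift[OF y])
  have zk: "z u = y 0" if "of_int k < u" "u < of_int k + b" for u
    unfolding z_def using that by (intro b(2)) auto
  have "z 0 \<in> K" using K[of "-k"] by (simp add: z_def)
  then have "\<not> occupied (\<lambda>\<rho>. loc \<rho> 0) (z 0)"
    using loc_0[of _ "z 0"] loc_eq_None_iff[of "z 0" 0] tau[of "z 0"] by (force simp: occupied_def)
  then have free: "loc \<sigma> u \<noteq> Some (z u)" if "0 \<le> u" "\<sigma> < n" for u \<sigma>
    using unoccupied_forever[OF z order_refl that(1)] that(2) by (auto simp: occupied_def)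
  have kt: "of_int k < t" "t < of_int k + b" using k v by auto
  from on_circle_cases[OF t(3)] show False
  proof
    assume "loc \<rho> t = Some (y 0)"
    with free[OF t(1,2)] zk[OF kt] show False by simp
  next
    assume "\<forall>\<^sub>F u in at_left t. loc \<rho> u = Some (y 0)"
    with eventually_at_left_real[OF kt(1)] have "\<forall>\<^sub>F u in at_left t. False"
    proof eventually_elim
      case (elim u)
      then have "of_int k < u" "u < of_int k + b" using kt by auto
      moreover have "0 \<le> u" using \<open>of_int k < u\<close> \<open>k \<ge> 0\<close> by linarith
      ultimately show ?case using free[of u \<rho>] zk[of u] elim t(2) by simp
    qed
    then show False using eventually_happens'[OF trivial_limit_at_left_real] by blast
  qed
qed

end

section \<open>Existence of runs and the criterion for coverage\<close>

context sync_system begin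

text \<open>The switching rule applied to all robots at once, so that a whole configuration is the
  state of a \<open>jump_process\<close>.\<close>

definition advance :: "real \<Rightarrow> (nat \<Rightarrow> nat option) \<Rightarrow> nat \<Rightarrow> nat option" where
  "advance t L \<rho> = (if \<rho> < n then map_option (\<lambda>i. if occupied L (sw t i) then i else sw t i) (L \<rho>) else L \<rho>)"

lemma advance_id: "sw t = id \<Longrightarrow> advance t = id"
  by (auto simp: fun_eq_iff advance_def occupied_def intro!: option.map_ident_strong)

text \<open>Resilience quantifies over all runs; this makes sure that a bad choice of
  \<open>K\<close> is witnessed by an actual run.\<close>

lemma run_exists: "\<exists>loc. partial_scs_run n c r f g K (\<lambda>_. 0) loc"
proof -
  interpret adv: jump_process advance
  proof
    show "finite {u. a \<le> u \<and> u \<le> b \<and> advance u \<noteq> id}" for a b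
      by (rule finite_subset[OF _ finite_swaps[of a b]]) (use advance_id in auto)
  qed
  define init where "init = (\<lambda>\<rho>. if \<rho> \<in> K then None else Some \<rho>)"
  define loc where "loc \<rho> t = adv.forward init t \<rho>" for \<rho> t
  have inv: "\<forall>\<rho><n. (adv.forward init t \<rho> = None \<longleftrightarrow> \<rho> \<in> K) \<and> (\<forall>i. adv.forward init t \<rho> = Some i \<longrightarrow> i < n)" for t
    by (rule adv.forward_invariant) (auto simp: init_def advance_def)
  show ?thesis
    unfolding partial_scs_run_def
  proof (intro exI[of _ loc] conjI allI impI)
    fix t :: real assume "0 \<le> t"
    obtain b where b: "b > t" "\<And>u. t < u \<Longrightarrow> u < b \<Longrightarrow> adv.forward init u = adv.forward init t"
      using adv.forward_right[OF \<open>0 \<le> t\<close>, of init] unfolding eventually_at_right_field by auto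
    have *: "loc \<rho> s = loc \<rho> t" if "t \<le> s" "s < t + (b - t)" for \<rho> s
      using that b(2)[of s] by (cases "s = t") (auto simp: loc_def)
    show "\<exists>e>0. \<forall>\<rho><n. \<forall>s. t \<le> s \<and> s < t + e \<longrightarrow> loc \<rho> s = loc \<rho> t"
      by (intro exI[of _ "b - t"] conjI allI impI *) (use b(1) in simp_all)
  next
    fix t :: real assume "0 < t"
    then obtain L where L: "\<forall>\<^sub>F u in at_left t. adv.forward init u = L" "adv.forward init t = advance t L"
      using adv.forward_left by blast
    obtain b where b: "b < t" "\<And>u. b < u \<Longrightarrow> u < t \<Longrightarrow> adv.forward init u = L"
      using L(1) unfolding eventually_at_left_field by auto
    define e where "e = min t (t - b)"
    have e: "e > 0" "e \<le> t" "\<forall>\<rho><n. \<forall>s. t - e < s \<and> s < t \<longrightarrow> loc \<rho> s = L \<rho>"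
      using \<open>0 < t\<close> b by (auto simp: e_def loc_def min_def split: if_splits)
    moreover have "switch_ok n c r f g L t (\<lambda>\<rho>. loc \<rho> t)"
      unfolding switch_ok_iff loc_def L(2) by (simp add: advance_def)
    ultimately show "\<exists>L. (\<exists>e>0. e \<le> t \<and> (\<forall>\<rho><n. \<forall>s. t - e < s \<and> s < t \<longrightarrow> loc \<rho> s = L \<rho>))
               \<and> switch_ok n c r f g L t (\<lambda>\<rho>. loc \<rho> t)" by blast
  qed (use inv in \<open>auto simp: loc_def init_def\<close>)
qed

lemma all_covered_iff:
  assumes "k \<le> n"
  shows "(\<forall>K tau loc. K \<subseteq> {..<n} \<and> card K = k \<and> (\<forall>\<rho>. 0 \<le> tau \<rho>) \<and>
             partial_scs_run n c r f g K tau loc \<longrightarrow> (\<forall>i<n. covered n c f g loc i))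
    \<longleftrightarrow> (\<forall>m y. has_period m y \<longrightarrow> k < m)" (is "?L \<longleftrightarrow> ?R")
proof
  assume ?R
  show ?L
  proof (intro allI impI, elim conjE)
    fix K tau loc i
    assume *: "K \<subseteq> {..<n}" "card K = k" "partial_scs_run n c r f g K tau loc" "i < n"
    interpret scs_run n c r f g K tau loc by standard (rule *)
    show "covered n c f g loc i"
      using covered_if_few_leave * \<open>?R\<close> by blast
  qed
next
  assume ?L
  show ?R
  proof (intro allI impI, rule ccontr)
    fix m y assume per: "has_period m y" and "\<not> k < m"
    define D where "D = range (\<lambda>k. y (of_int k))"
    have D: "card D \<le> k" "D \<subseteq> {..<n}"
      using periodic_orbit[OF per] \<open>\<not> k < m\<close> by (auto simp: D_def)
    \<comment> \<open>Exactly \<open>k\<close> robots have to leave, so the starting circles of the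
      ring are padded to a set of that size.\<close>
    obtain K where K: "D \<subseteq> K" "K \<subseteq> {..<n}" "card K = k"
      using exists_subset_between[OF D(1) _ D(2)] assms by auto
    obtain loc where loc: "partial_scs_run n c r f g K (\<lambda>_. 0) loc"
      using run_exists by blast
    interpret scs_run n c r f g K "\<lambda>_. 0" loc by standard (rule loc)
    have "\<not> covered n c f g loc (y 0)"
      by (rule not_covered_if_orbit_leaves[OF per]) (use K(1) in \<open>auto simp: D_def\<close>)
    moreover have "y 0 < n"
      using per trajectory_less by (auto simp: has_period_def)
    ultimately show False
      using \<open>?L\<close>[rule_format, of K "\<lambda>_. 0" loc "y 0"] K(2,3) loc by blast
  qed
qed

end

section \<open>Comparing two schedules\<close>

locale two_schedules =
  one: sync_system n c r f1 g1 + two: sync_system n c r f2 g2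
  for n c r f1 g1 f2 g2
begin

text \<open>The relation spreads along edges: when circle \<open>j\<close> is at its link to
  \<open>k\<close>, synchrony places \<open>k\<close> at its own link in both schedules, and the
  directions of \<open>j\<close> and \<open>k\<close> are opposite in both.\<close>

lemma schedules_related:
  assumes i: "i < n"
  obtains \<kappa> \<theta> where "\<kappa> = 1 \<or> \<kappa> = -1"
    "\<And>j t. (comm_adj n c r)\<^sup>*\<^sup>* i j \<Longrightarrow> sched_point c f2 g2 j t = sched_point c f1 g1 j (\<kappa> * t + \<theta>)"
proof -
  \<comment> \<open>The sign says whether the directions on \<open>i\<close> agree, and
    \<open>\<theta>\<close> solves the equation of the two angles on \<open>i\<close>.\<close>
  define \<kappa> where "\<kappa> = g2 i * g1 i"
  define \<theta> where "\<theta> = g1 i * (f2 i - f1 i) / (2 * pi)"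
  have g: "g1 i = 1 \<or> g1 i = -1" "g2 i = 1 \<or> g2 i = -1"
    using one.g_cases two.g_cases i by auto
  have \<kappa>: "\<kappa> = 1 \<or> \<kappa> = -1" using g by (auto simp: \<kappa>_def)
  have "j < n \<and> g2 j = \<kappa> * g1 j \<and> (\<forall>t. sched_point c f2 g2 j t = sched_point c f1 g1 j (\<kappa> * t + \<theta>))"
    if "(comm_adj n c r)\<^sup>*\<^sup>* i j" for j
    using that
  proof (induction rule: rtranclp_induct)
    case base
    have "f1 i + g1 i * 2 * pi * (\<kappa> * t + \<theta>) = f2 i + g2 i * 2 * pi * t" for t
      using g by (auto simp: \<kappa>_def \<theta>_def field_simps)
    then show ?case using g i by (auto simp: sched_point_def \<kappa>_def)
  next
    case (step j k)
    have gk: "g2 k = \<kappa> * g1 k"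
      using step one.g_adj[OF step(2)] two.g_adj[OF step(2)] by simp
    obtain u where u: "sched_point c f2 g2 j u = link_point c j k"
      using two.pos_surj[OF _ one.norm_link[OF step(2)]] step by blast
    then have "sched_point c f1 g1 j (\<kappa> * u + \<theta>) = link_point c j k"
      using step by simp
    with u have eq: "sched_point c f2 g2 k u = sched_point c f1 g1 k (\<kappa> * u + \<theta>)"
      using one.pos_link_iff[OF step(2)] two.pos_link_iff[OF step(2)] by simp
    \<comment> \<open>One position and the direction determine the motion, so a single coincidence
      on \<open>k\<close> suffices.\<close>
    have rot: "sched_point c f g k b - c k = (sched_point c f g k a - c k) * cis (g k * 2 * pi * (b - a))"
      for f g a b by (simp add: sched_point_def cis_mult algebra_simps)
    have "sched_point c f2 g2 k t - c k = sched_point c f1 g1 k (\<kappa> * t + \<theta>) - c k" for t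
    proof -
      have "g2 k * 2 * pi * (t - u) = g1 k * 2 * pi * ((\<kappa> * t + \<theta>) - (\<kappa> * u + \<theta>))"
        by (simp add: gk algebra_simps)
      then show ?thesis
        using rot[of f2 g2 t u] rot[of f1 g1 "\<kappa> * t + \<theta>" "\<kappa> * u + \<theta>"] eq by (simp only:)
    qed
    then show ?case using gk one.adj_less(2)[OF step(2)] by simp
  qed
  then show ?thesis using \<kappa> that by blast
qed

text \<open>A trajectory never leaves its connected component, where the swaps of the two schedules
  agree after the change of time; composing with that change gives the required trajectory.\<close>

lemma period_transfer:
  assumes per: "one.has_period m y"
  shows "\<exists>z. two.has_period m z"
proof -
  have y: "one.trajectory y" and m: "m > 0" using per by (auto simp: one.has_period_def)
  define C where "C = {j. (comm_adj n c r)\<^sup>*\<^sup>* (y 0) j}"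
  obtain \<kappa> \<theta> where \<kappa>: "\<kappa> = 1 \<or> \<kappa> = -1"
    and rel: "\<And>j t. (comm_adj n c r)\<^sup>*\<^sup>* (y 0) j \<Longrightarrow>
      sched_point c f2 g2 j t = sched_point c f1 g1 j (\<kappa> * t + \<theta>)"
    by (rule schedules_related[OF one.trajectory_less[OF y, of 0]]) (rule that)
  have sw: "two.sw t j = one.sw (\<kappa> * t + \<theta>) j" if "j \<in> C" for t j
    using that unfolding C_def mem_Collect_eq by (simp only: swap_def rel)
  have C: "one.sw t j \<in> C" if "j \<in> C" for t j
  proof (rule one.swap_cases[of j t])
    assume "comm_adj n c r j (one.sw t j)"
    with that show ?thesis
      unfolding C_def mem_Collect_eq by (rule rtranclp.rtrancl_into_rtrancl)
  next
    assume "one.sw t j = j"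
    with that show ?thesis by simp
  qed
  have "one.sw t j \<in> C \<longleftrightarrow> j \<in> C" for t j
    using C[of j t] C[of "one.sw t j" t] by auto
  then have yC: "y t \<in> C" for t
    using one.trajectory_invariant[OF y, of "\<lambda>j. j \<in> C" 0 t] by (auto simp: C_def)
  from \<kappa> show ?thesis
  proof
    assume [simp]: "\<kappa> = 1"
    have "two.trajectory (\<lambda>t. y (t + \<theta>))"
      unfolding two.trajectory_def
    proof safe
      fix t
      show "y (t + \<theta>) < n" by (rule one.trajectory_less[OF y])
      show "\<forall>\<^sub>F u in at_right t. y (u + \<theta>) = y (t + \<theta>)"
        by (subst eventually_at_right_shift) (rule one.trajectory_right[OF y])
      show "\<forall>\<^sub>F u in at_left t. y (u + \<theta>) = two.sw t (y (t + \<theta>))"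
        by (subst eventually_at_left_shift) (use one.trajectory_left[OF y] sw[OF yC] in simp)
    qed
    moreover have "y (t + real m + \<theta>) = y (t + \<theta>)" for t
      using per by (auto simp: one.has_period_def algebra_simps dest: spec[of _ "t + \<theta>"])
    ultimately show ?thesis using m by (auto simp: two.has_period_def)
  next
    assume [simp]: "\<kappa> = -1"
    \<comment> \<open>Plain reversal of \<open>y\<close> would be left continuous; the swap replaces
      each value by the left limit of \<open>y\<close>, restoring right continuity.\<close>
    define z where "z t = one.sw (\<theta> - t) (y (\<theta> - t))" for t
    have zr: "two.sw t (z t) = y (\<theta> - t)" for t
      using sw[OF C[OF yC], of t] by (simp add: z_def)
    \<comment> \<open>Close to \<open>t\<close> but not at \<open>t\<close> there are no swaps, so
      there \<open>z\<close> is simply the reversal of \<open>y\<close>.\<close>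
    have idle_left: "\<forall>\<^sub>F u in at_left t. one.sw u = id" for t
      using finite_eventually_at_left[OF one.finite_swaps, of t] eventually_at_left_real[of "t - 1" t, simplified]
      by eventually_elim auto
    have idle_right: "\<forall>\<^sub>F u in at_right t. one.sw u = id" for t
      using finite_eventually_at_right[OF one.finite_swaps, of t] eventually_at_right_less[of t]
      by eventually_elim auto
    have "two.trajectory z"
      unfolding two.trajectory_def
    proof safe
      fix t
      show "z t < n" using one.trajectory_less[OF y] by (simp add: z_def)
      have "\<forall>\<^sub>F u in at_left (\<theta> - t). one.sw u (y u) = z t"
        using one.trajectory_left[OF y, of "\<theta> - t"] idle_left[of "\<theta> - t"]
        by eventually_elim (simp add: z_def)
      then show "\<forall>\<^sub>F u in at_right t. z u = z t"
        using eventually_at_right_reflect[of "\<lambda>u. one.sw u (y u) = z t" \<theta> t] by (simp add: z_def)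
      have "\<forall>\<^sub>F u in at_right (\<theta> - t). one.sw u (y u) = two.sw t (z t)"
        using one.trajectory_right[OF y, of "\<theta> - t"] idle_right[of "\<theta> - t"]
        by eventually_elim (simp add: zr)
      then show "\<forall>\<^sub>F u in at_left t. z u = two.sw t (z t)"
        using eventually_at_left_reflect[of "\<lambda>u. one.sw u (y u) = two.sw t (z t)" \<theta> t] by (simp add: z_def)
    qed
    moreover have "z (t + real m) = z t" for t
      using one.has_period_int[OF per, of "\<theta> - t" "-1"] one.periodic_int[of "\<theta> - t" "- int m"]
      by (simp add: z_def algebra_simps)
    ultimately show ?thesis using m by (auto simp: two.has_period_def)
  qed
qed

end

theorem theorem4:
  fixes n :: nat and c :: "nat \<Rightarrow> complex" and r :: real
    and f1 g1 f2 g2 :: "nat \<Rightarrow> real"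
  assumes "r > 0"
    and "disjoint_unit_circles n c"
    and "sync_schedule n c r f1 g1"
    and "sync_schedule n c r f2 g2"
    and "(f1, g1) \<noteq> (f2, g2)"
  shows "uncovering_resilience n c r f1 g1 = uncovering_resilience n c r f2 g2"
proof -
  interpret one: sync_system n c r f1 g1 by standard (rule assms)+
  interpret two: sync_system n c r f2 g2 by standard (rule assms)+
  interpret st: two_schedules n c r f1 g1 f2 g2 ..
  interpret ts: two_schedules n c r f2 g2 f1 g1 ..
  \<comment> \<open>Periods transfer in both directions because the two schedules may exchange
    roles.\<close>
  have "(\<forall>m y. one.has_period m y \<longrightarrow> k < m) \<longleftrightarrow> (\<forall>m y. two.has_period m y \<longrightarrow> k < m)" for k
    using st.period_transfer ts.period_transfer by blast
  then show ?thesis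
    unfolding uncovering_resilience_def
    by (intro arg_cong[of _ _ Greatest] ext conj_cong refl) (simp only: one.all_covered_iff two.all_covered_iff)
qed

end
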